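(* Let $P$ be a bounded convex polygonal domain ($n$-gon, $n\ge 3$) in $\mathbb{C}$. Then the maximum of $2d_P(u)/r_P(u)$ over $u\in P$ is attained at some point of the graph $Gr(P)$.
   Context: For a proper subdomain $D$ of $\mathbb{C}$ and $z\in D$, $d_D(z)=\inf\{|z-\zeta|:\zeta\in\partial D\}$. For a simply connected proper subdomain $D\subset\mathbb{C}$ and $z_0\in D$, the conformal radius $r_D(z_0)$ is $F'(0)$, where $F$ is the conformal map of the unit disk onto $D$ with $F(0)=z_0$, $F'(0)>0$. Definition of $Gr(P)$: decompose the bounded convex $n$-gon $P$ as $P=\bigcup_{j=1}^n P_j$, where $P_j$ is the set of points of $P$ which are closer to the $j$-th side of $P$ than to the others (points equidistant from several nearest sides lie on the common boundaries of the corresponding parts). The set $\bigcup_{j=1}^n\partial P_j$ is a graph (its edges are straight line segments). $Gr(P)$ is the subgraph obtained from it by removing all boundary points of $P$ and all open edges (edges without their endpoints) that reach $\partial P$, i.e. those edges having an endpoint on $\partial P$. Endpoints of removed edges lying in the interior of $P$ are kept. For example, if $P$ is the rectangle $[-k,k]\times[-1,1]$ with $k\ge1$, then $Gr(P)$ is the segment $[-(k-1),k-1]$ of the real axis; if $P$ has an inscribed circle (tangent to all sides), then $Gr(P)$ is the single point which is the center of that circle. *)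

theory Defs
  imports "HOL-Complex_Analysis.Complex_Analysis"
begin

definition boundary_dist :: "complex set \<Rightarrow> complex \<Rightarrow> real" where
  "boundary_dist D z = infdist z (frontier D)"

definition is_normalized_conformal_map ::
    "complex set \<Rightarrow> complex \<Rightarrow> (complex \<Rightarrow> complex) \<Rightarrow> bool" where
  "is_normalized_conformal_map D z0 F \<longleftrightarrow>
     F holomorphic_on ball 0 1 \<and> bij_betw F (ball 0 1) D \<and> F 0 = z0 \<and>
     deriv F 0 \<in> \<real> \<and> Re (deriv F 0) > 0"

text \<open>The Riemann map is unique on the unit disk but arbitrary outside it as a HOL function,
  so the description operator is applied to the derivative rather than to the map.\<close>

definition conformal_radius :: "complex set \<Rightarrow> complex \<Rightarrow> real" where
  "conformal_radius D z0 =
     (THE r. \<exists>F. is_normalized_conformal_map D z0 F \<and> deriv F 0 = complex_of_real r)"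

text \<open>The sides of a polygonal domain, as closed segments.\<close>

definition sides :: "complex set \<Rightarrow> complex set set" where
  "sides P = {L. L facet_of closure P}"

definition convex_ngon_domain :: "nat \<Rightarrow> complex set \<Rightarrow> bool" where
  "convex_ngon_domain n P \<longleftrightarrow>
     open P \<and> convex P \<and> P \<noteq> {} \<and> bounded P \<and> polytope (closure P) \<and> card (sides P) = n"

text \<open>The part of \<open>P\<close> belonging to the side \<open>L\<close>. Points with several nearest sides
  are put into each of the corresponding parts, so that the parts cover \<open>P\<close>.\<close>

definition part :: "complex set \<Rightarrow> complex set \<Rightarrow> complex set" where
  "part P L = {z \<in> P. \<forall>M \<in> sides P. infdist z L \<le> infdist z M}"

text \<open>The edges of the graph formed by the boundaries of the parts. The parts are convex
  polygons that meet edge to edge, since three distinct sides cannot be simultaneously nearest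
  along a nondegenerate segment. So the edges of the graph are the sides of the parts;
  these include the sides of \<open>P\<close> itself.\<close>

definition graph_edges :: "complex set \<Rightarrow> complex set set" where
  "graph_edges P = (\<Union>L \<in> sides P. sides (part P L))"

definition endpoints :: "complex set \<Rightarrow> complex set" where
  "endpoints E = {x. x extreme_point_of E}"

definition Gr :: "complex set \<Rightarrow> complex set" where
  "Gr P = (\<Union>L \<in> sides P. frontier (part P L)) - frontier P
          - \<Union>{E - endpoints E | E. E \<in> graph_edges P \<and> endpoints E \<inter> frontier P \<noteq> {}}"

end

theory Submission
  imports Defs
begin

text \<open>
  Write \<open>d\<close> for the distance to the boundary and \<open>r\<close> for the conformal radius.

  The function \<open>r\<close> is concave on a convex domain: if \<open>F\<close> and \<open>H\<close> are the normalized Riemann maps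
  with centers \<open>x\<close> and \<open>y\<close>, then \<open>u F + v H\<close> (with \<open>u, v \<ge> 0\<close>, \<open>u + v = 1\<close>) maps the disk into the
  domain and has derivative \<open>u r x + v r y\<close> at \<open>0\<close>, which by the Schwarz lemma is at most the
  conformal radius at \<open>u x + v y\<close> (\<open>concave_on_conformal_radius\<close>). Extended by zero to the boundary,
  \<open>r\<close> is concave on the closed polygon (\<open>concave_on_closure_extend_zero\<close>).

  On the closure of the part of a side, \<open>d\<close> is the distance to the line of that side, hence
  affine (\<open>boundary_dist_eq_height\<close>), and this closure is a convex polygon. So for \<open>m \<ge> 0\<close> the set of
  its points with \<open>d \<le> m r\<close> is convex, and it contains the vertices on the boundary, where
  \<open>d = r = 0\<close>. If it also contains the vertices inside \<open>P\<close>, it contains the whole part. Therefore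
  \<open>d / r\<close> attains its maximum over \<open>P\<close> at one of the finitely many vertices of parts that lie in
  \<open>P\<close> (\<open>boundary_dist_le_of_inner_vertices\<close>).

  Among these maximizing vertices take one, \<open>u\<close>, with the largest \<open>d\<close>. It cannot lie inside an
  edge with an endpoint \<open>p\<close> on the boundary: on such an edge \<open>d\<close> grows linearly from \<open>0\<close> at \<open>p\<close>, and
  \<open>d / r\<close> does not decrease because \<open>r\<close> is concave and nonnegative, so the other endpoint would
  be a maximizing vertex with larger \<open>d\<close> (\<open>higher_vertex\<close>). Hence \<open>u\<close> belongs to the graph.
\<close>

section \<open>Concavity of the conformal radius\<close>

lemma exists_normalized_conformal_map:
  assumes "open D" "simply_connected D" "D \<noteq> UNIV" "z \<in> D"
  shows "\<exists>F. is_normalized_conformal_map D z F"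
proof -
  obtain f g where g: "g holomorphic_on ball 0 1"
    and fg: "\<And>z. z \<in> D \<Longrightarrow> f z \<in> ball 0 1 \<and> g (f z) = z"
    and gf: "\<And>w. w \<in> ball 0 1 \<Longrightarrow> g w \<in> D \<and> f (g w) = w"
    using assms Riemann_mapping_theorem[of D] by (metis empty_iff)
  have "f z \<in> ball 0 1" using fg assms by blast
  then obtain p q where p0: "p (f z) = 0" and "p holomorphic_on ball 0 1"
    and pim: "p ` ball 0 1 \<subseteq> ball 0 1"
    and q: "q holomorphic_on ball 0 1" and qim: "q ` ball 0 1 \<subseteq> ball 0 1"
    and pq: "\<And>w. w \<in> ball 0 1 \<Longrightarrow> p (q w) = w"
    and qp: "\<And>w. w \<in> ball 0 1 \<Longrightarrow> q (p w) = w"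
    using ball_biholomorphism_exists by metis
  define G where "G = g \<circ> q"
  have holG: "G holomorphic_on ball 0 1"
    unfolding G_def using holomorphic_on_compose_gen[OF q g] qim by blast
  have bijG: "bij_betw G (ball 0 1) D"
    by (rule bij_betw_byWitness[where f' = "p \<circ> f"])
       (use fg gf pq qp pim qim in \<open>auto simp: G_def image_subset_iff\<close>)
  have G0: "G 0 = z"
    using qp[OF \<open>f z \<in> ball 0 1\<close>] p0 fg[OF \<open>z \<in> D\<close>] by (simp add: G_def)
  \<comment> \<open>A rotation of the disk makes the derivative at the center positive.\<close>
  have nz: "deriv G 0 \<noteq> 0"
    using holomorphic_injective_imp_regular[OF holG] bijG by (auto simp: bij_betw_def)
  define c where "c = cnj (deriv G 0) / norm (deriv G 0)"
  have nc: "norm c = 1" using nz by (simp add: c_def norm_divide)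
  define F where "F = (\<lambda>w. G (c * w))"
  have rot: "bij_betw (\<lambda>w. c * w) (ball 0 1) (ball 0 1)"
    by (rule bij_betw_byWitness[where f' = "\<lambda>w. w / c"])
       (use nc in \<open>auto simp: norm_mult norm_divide\<close>)
  have "F holomorphic_on ball 0 1"
    unfolding F_def
    using holomorphic_on_compose_gen[of "\<lambda>w. c * w" "ball 0 1" G "ball 0 1"] holG nc
    by (force simp: o_def norm_mult intro: holomorphic_intros)
  moreover have "bij_betw F (ball 0 1) D"
    using bij_betw_trans[OF rot bijG] by (simp add: F_def o_def)
  moreover have "F 0 = z" by (simp add: F_def G0)
  moreover have "deriv F 0 = norm (deriv G 0)"
  proof -
    have "(G has_field_derivative deriv G 0) (at (c * 0))"
      using holomorphic_derivI[OF holG, of 0] by simp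
    then have "(F has_field_derivative deriv G 0 * c) (at 0)"
      unfolding F_def by (rule DERIV_chain2) (auto intro!: derivative_eq_intros)
    then have "deriv F 0 = deriv G 0 * c" by (rule DERIV_imp_deriv)
    also have "\<dots> = norm (deriv G 0)"
      using nz by (simp add: c_def complex_norm_square[symmetric] power2_eq_square)
    finally show ?thesis .
  qed
  ultimately have "is_normalized_conformal_map D z F"
    using nz by (simp add: is_normalized_conformal_map_def)
  then show ?thesis by blast
qed

text \<open>The Schwarz lemma for \<open>F\<^sup>-\<^sup>1 \<circ> G\<close>.\<close>

lemma subordination_deriv_le:
  assumes F: "is_normalized_conformal_map D z F"
    and G: "G holomorphic_on ball 0 1" "G ` ball 0 1 \<subseteq> D" "G 0 = z"
  shows "norm (deriv G 0) \<le> Re (deriv F 0)"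
proof -
  have holF: "F holomorphic_on ball 0 1" and bij: "bij_betw F (ball 0 1) D" and F0: "F 0 = z"
    and real: "deriv F 0 \<in> \<real>" and pos: "Re (deriv F 0) > 0"
    using F by (auto simp: is_normalized_conformal_map_def)
  have im: "F ` ball 0 1 = D" and inj: "inj_on F (ball 0 1)"
    using bij by (auto simp: bij_betw_def)
  obtain k where holk: "k holomorphic_on D"
    and dk: "\<And>w. w \<in> ball 0 1 \<Longrightarrow> deriv F w * deriv k (F w) = 1"
    and kF: "\<And>w. w \<in> ball 0 1 \<Longrightarrow> k (F w) = w"
    using holomorphic_has_inverse[OF holF open_ball inj] im by metis
  have opD: "open D" using open_mapping_thm3[OF holF open_ball inj] im by simp
  have kim: "k w \<in> ball 0 1" if "w \<in> D" for w using that im kF by auto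
  have zD: "z \<in> D" using im F0 by force
  have k0: "k z = 0" using kF[of 0] F0 by simp
  define h where "h = k \<circ> G"
  have holh: "h holomorphic_on ball 0 1"
    unfolding h_def using holomorphic_on_compose_gen[OF G(1) holk] G(2) by blast
  have "norm (h w) < 1" if "norm w < 1" for w
    using kim[of "G w"] G(2) that by (auto simp: h_def image_subset_iff)
  then have le1: "norm (deriv h 0) \<le> 1"
    using Schwarz_Lemma(2)[OF holh, of 0] k0 G(3) by (simp add: h_def)
  have "deriv h 0 = deriv k z * deriv G 0"
    using deriv_chain[of G 0 k] holomorphic_on_imp_differentiable_at[OF holk opD zD]
      holomorphic_on_imp_differentiable_at[OF G(1), of 0] G(3) by (simp add: h_def)
  then have "deriv G 0 = deriv F 0 * deriv h 0"
    using dk[of 0] F0 by (simp add: mult.assoc[symmetric])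
  then have "norm (deriv G 0) \<le> norm (deriv F 0)"
    using le1 by (simp add: norm_mult mult_left_le)
  also have "\<dots> = Re (deriv F 0)"
    using real pos by (auto elim!: Reals_cases)
  finally show ?thesis .
qed

text \<open>The derivative at \<open>0\<close> does not depend on the normalized map: any two are subordinate to each
  other.\<close>

lemma conformal_radius_eq:
  assumes F: "is_normalized_conformal_map D z F"
  shows "conformal_radius D z = Re (deriv F 0)"
  unfolding conformal_radius_def
proof (rule the_equality)
  have "deriv F 0 = complex_of_real (Re (deriv F 0))"
    using F by (auto simp: is_normalized_conformal_map_def elim!: Reals_cases)
  with F show "\<exists>F'. is_normalized_conformal_map D z F' \<and> deriv F' 0 = complex_of_real (Re (deriv F 0))"
    by blast
next
  fix r assume "\<exists>F'. is_normalized_conformal_map D z F' \<and> deriv F' 0 = complex_of_real r"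
  then obtain F' where F': "is_normalized_conformal_map D z F'" "deriv F' 0 = complex_of_real r"
    by blast
  have *: "F holomorphic_on ball 0 1 \<and> F ` ball 0 1 \<subseteq> D \<and> F 0 = z"
    if "is_normalized_conformal_map D z F" for F
    using that by (auto simp: is_normalized_conformal_map_def bij_betw_def)
  have "norm (deriv F' 0) \<le> Re (deriv F 0)" "norm (deriv F 0) \<le> Re (deriv F' 0)"
    using subordination_deriv_le[OF F, of F'] subordination_deriv_le[OF F'(1), of F]
      *[OF F] *[OF F'(1)] by auto
  then show "r = Re (deriv F 0)"
    using F'(2) complex_Re_le_cmod[of "deriv F 0"] complex_Re_le_cmod[of "deriv F' 0"] by simp
qed

lemma conformal_radius_pos:
  assumes "open D" "simply_connected D" "D \<noteq> UNIV" "z \<in> D"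
  shows "conformal_radius D z > 0"
  using exists_normalized_conformal_map[OF assms] conformal_radius_eq
  by (auto simp: is_normalized_conformal_map_def)

lemma concave_on_conformal_radius:
  assumes "open D" "convex D" "D \<noteq> UNIV"
  shows "concave_on D (conformal_radius D)"
  unfolding concave_on_iff
proof (intro conjI ballI allI impI)
  fix x y :: complex and u v :: real
  assume xy: "x \<in> D" "y \<in> D" and uv: "0 \<le> u" "0 \<le> v" "u + v = 1"
  note ex = exists_normalized_conformal_map[OF \<open>open D\<close>
      convex_imp_simply_connected[OF \<open>convex D\<close>] \<open>D \<noteq> UNIV\<close>]
  have mem: "u *\<^sub>R a + v *\<^sub>R b \<in> D" if "a \<in> D" "b \<in> D" for a b
    using convexD[OF \<open>convex D\<close> that uv] .
  obtain F H K where F: "is_normalized_conformal_map D x F"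
    and H: "is_normalized_conformal_map D y H"
    and K: "is_normalized_conformal_map D (u *\<^sub>R x + v *\<^sub>R y) K"
    using ex xy mem by metis
  \<comment> \<open>By convexity the average of the two Riemann maps still maps the disk into \<open>D\<close>.\<close>
  define G where "G = (\<lambda>w. of_real u * F w + of_real v * H w)"
  have hol: "F holomorphic_on ball 0 1" "H holomorphic_on ball 0 1"
    using F H by (auto simp: is_normalized_conformal_map_def)
  have "(F has_field_derivative deriv F 0) (at 0)" "(H has_field_derivative deriv H 0) (at 0)"
    using holomorphic_derivI[OF hol(1), of 0] holomorphic_derivI[OF hol(2), of 0] by auto
  then have "(G has_field_derivative of_real u * deriv F 0 + of_real v * deriv H 0) (at 0)"
    unfolding G_def by (auto intro!: derivative_eq_intros)
  then have "deriv G 0 = of_real u * deriv F 0 + of_real v * deriv H 0"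
    by (rule DERIV_imp_deriv)
  then have "u * Re (deriv F 0) + v * Re (deriv H 0) \<le> norm (deriv G 0)"
    using complex_Re_le_cmod[of "deriv G 0"] by simp
  also have "\<dots> \<le> Re (deriv K 0)"
  proof (rule subordination_deriv_le[OF K])
    show "G holomorphic_on ball 0 1"
      unfolding G_def using hol by (intro holomorphic_intros)
    show "G ` ball 0 1 \<subseteq> D"
      using bij_betwE F H mem unfolding G_def is_normalized_conformal_map_def
      by (fastforce simp: scaleR_conv_of_real)
    show "G 0 = u *\<^sub>R x + v *\<^sub>R y"
      using F H by (simp add: G_def is_normalized_conformal_map_def scaleR_conv_of_real)
  qed
  finally show "u * conformal_radius D x + v * conformal_radius D y
      \<le> conformal_radius D (u *\<^sub>R x + v *\<^sub>R y)"
    by (simp add: conformal_radius_eq[OF F] conformal_radius_eq[OF H] conformal_radius_eq[OF K])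
qed (fact \<open>convex D\<close>)

text \<open>A nonnegative concave function on an open convex set stays concave when it is extended by
  zero to the boundary.\<close>

lemma concave_on_closure_extend_zero:
  fixes r :: "'a::euclidean_space \<Rightarrow> real"
  assumes "open D" "concave_on D r" and pos: "\<And>x. x \<in> D \<Longrightarrow> 0 \<le> r x"
  shows "concave_on (closure D) (\<lambda>x. if x \<in> D then r x else 0)"
  unfolding concave_on_iff
proof (intro conjI ballI allI impI)
  have cvx: "convex D" using assms(2) by (simp add: concave_on_iff)
  then show "convex (closure D)" by (rule convex_closure)
  let ?R = "\<lambda>x. if x \<in> D then r x else 0"
  have cc: "u * r x + v * r y \<le> r (u *\<^sub>R x + v *\<^sub>R y)"
    if "x \<in> D" "y \<in> D" "0 \<le> u" "0 \<le> v" "u + v = 1" for x y u v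
    using assms(2) that by (auto simp: concave_on_iff)
  have half: "u * r x \<le> ?R (u *\<^sub>R x + v *\<^sub>R y)"
    if x: "x \<in> D" and y: "y \<in> closure D" and uv: "0 \<le> u" "0 \<le> v" "u + v = 1" for x y u v
  proof (cases "u = 0")
    case True then show ?thesis using pos by simp
  next
    case False
    have inD: "y - e *\<^sub>R (y - x) \<in> D" if "0 < e" "e \<le> 1" for e
      using mem_interior_closure_convex_shrink[OF cvx _ y that, of x] x \<open>open D\<close>
      by (simp add: interior_open)
    have eq: "u *\<^sub>R x + v *\<^sub>R y = y - u *\<^sub>R (y - x)"
      using uv by (simp add: algebra_simps flip: scaleR_add_left)
    have memD: "u *\<^sub>R x + v *\<^sub>R y \<in> D" using inD[of u] False uv eq by simp
    \<comment> \<open>The point is a convex combination of \<open>x\<close> and a point of \<open>D\<close> slightly before \<open>y\<close>.\<close>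
    have bound: "w * r x \<le> r (u *\<^sub>R x + v *\<^sub>R y)" if w: "0 \<le> w" "w < u" for w
    proof -
      define e where "e = (u - w) / (1 - w)"
      have e: "0 < e" "e \<le> 1" "w + (1 - w) * e = u"
        using w uv by (auto simp: e_def field_simps)
      have "w *\<^sub>R x + (1 - w) *\<^sub>R (y - e *\<^sub>R (y - x))
          = y - (w + (1 - w) * e) *\<^sub>R (y - x)"
        by (simp add: algebra_simps)
      then have "w *\<^sub>R x + (1 - w) *\<^sub>R (y - e *\<^sub>R (y - x)) = u *\<^sub>R x + v *\<^sub>R y"
        using e eq by simp
      moreover have "w * r x + (1 - w) * r (y - e *\<^sub>R (y - x))
          \<le> r (w *\<^sub>R x + (1 - w) *\<^sub>R (y - e *\<^sub>R (y - x)))"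
        using cc[OF x inD[OF e(1,2)], of w "1 - w"] w uv by simp
      moreover have "0 \<le> (1 - w) * r (y - e *\<^sub>R (y - x))"
        using pos[OF inD[OF e(1,2)]] w uv by simp
      ultimately show ?thesis by simp
    qed
    have "u * r x \<le> r (u *\<^sub>R x + v *\<^sub>R y)"
    proof (rule field_le_mult_one_interval)
      fix s :: real assume "0 < s" "s < 1"
      then show "s * (u * r x) \<le> r (u *\<^sub>R x + v *\<^sub>R y)"
        using bound[of "s * u"] False uv by (simp add: mult.assoc)
    qed
    then show ?thesis using memD by simp
  qed
  fix x y :: 'a and u v :: real
  assume xy: "x \<in> closure D" "y \<in> closure D" and uv: "0 \<le> u" "0 \<le> v" "u + v = 1"
  show "u * ?R x + v * ?R y \<le> ?R (u *\<^sub>R x + v *\<^sub>R y)"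
  proof (cases "x \<in> D"; cases "y \<in> D")
    assume "x \<in> D" "y \<in> D"
    then show ?thesis using cc uv convexD[OF cvx] by simp
  next
    assume "x \<in> D" "y \<notin> D"
    then show ?thesis using half[of x y u v] xy uv by simp
  next
    assume "x \<notin> D" "y \<in> D"
    then show ?thesis using half[of y x v u] xy uv
      unfolding add.commute[of v u] add.commute[of "v *\<^sub>R y" "u *\<^sub>R x"] by simp
  next
    assume "x \<notin> D" "y \<notin> D"
    then show ?thesis using pos by simp
  qed
qed

section \<open>The parts of a convex polygon\<close>

text \<open>A convex polygonal domain together with the supporting lines of its sides: the side \<open>L\<close> lies
  on the line \<open>a L \<bullet> x = b L\<close>, where \<open>a L\<close> is the outward unit normal.\<close>

locale supported_polygon =
  fixes P :: "complex set" and a :: "complex set \<Rightarrow> complex" and b :: "complex set \<Rightarrow> real"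
  assumes open_P: "open P" and convex_P: "convex P" and nonempty_P: "P \<noteq> {}"
    and polytope_P: "polytope (closure P)"
    and norm_normal: "L \<in> sides P \<Longrightarrow> norm (a L) = 1"
    and support: "L \<in> sides P \<Longrightarrow> closure P \<subseteq> {x. a L \<bullet> x \<le> b L}"
    and side_eq: "L \<in> sides P \<Longrightarrow> L = closure P \<inter> {x. a L \<bullet> x = b L}"
begin

text \<open>The signed distance of \<open>z\<close> from the line of the side \<open>L\<close>, positive on the half-plane that
  contains \<open>P\<close>; an affine function of \<open>z\<close>.\<close>

definition height :: "complex set \<Rightarrow> complex \<Rightarrow> real" where
  "height L z = b L - a L \<bullet> z"

lemma finite_sides: "finite (sides P)"
  unfolding sides_def by (rule finite_polytope_facets[OF polytope_P])

lemma Union_sides: "\<Union>(sides P) = frontier P"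
proof -
  have int: "interior (closure P) = P"
    using convex_interior_closure[OF convex_P] open_P by (simp add: interior_open)
  then have "rel_interior (closure P) = P"
    using rel_interior_nonempty_interior[of "closure P"] nonempty_P by simp
  then show ?thesis
    using rel_boundary_of_polyhedron[OF polytope_imp_polyhedron[OF polytope_P]] open_P
    by (simp add: sides_def frontier_def interior_open)
qed

lemma bounded_P: "bounded P"
  using polytope_imp_bounded[OF polytope_P] bounded_subset closure_subset by blast

lemma P_not_UNIV: "P \<noteq> UNIV"
  using bounded_P not_bounded_UNIV by blast

lemma radius_pos: "x \<in> P \<Longrightarrow> conformal_radius P x > 0"
  using conformal_radius_pos[OF open_P convex_imp_simply_connected[OF convex_P] P_not_UNIV] .

text \<open>The conformal radius, extended by zero to the boundary of \<open>P\<close>.\<close>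

definition radius0 :: "complex \<Rightarrow> real" where
  "radius0 x = (if x \<in> P then conformal_radius P x else 0)"

lemma concave_radius0: "concave_on (closure P) radius0"
  unfolding radius0_def using radius_pos
  by (intro concave_on_closure_extend_zero concave_on_conformal_radius open_P convex_P P_not_UNIV)
     (simp add: less_imp_le)

lemma frontier_nonempty: "frontier P \<noteq> {}"
  using frontier_not_empty nonempty_P P_not_UNIV by blast

lemma boundary_dist_pos:
  assumes "z \<in> P" shows "boundary_dist P z > 0"
proof -
  have "z \<notin> frontier P" using assms open_P by (simp add: frontier_def interior_open)
  then show ?thesis
    using infdist_pos_not_in_closed[OF frontier_closed frontier_nonempty]
    by (simp add: boundary_dist_def)
qed

lemma boundary_dist_frontier: "z \<in> frontier P \<Longrightarrow> boundary_dist P z = 0"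
  by (simp add: boundary_dist_def)

lemma boundary_dist_le_infdist_side:
  assumes "L \<in> sides P" shows "boundary_dist P z \<le> infdist z L"
proof -
  have "L \<noteq> {}" using assms by (auto simp: sides_def facet_of_def)
  moreover have "L \<subseteq> frontier P" using assms Union_sides by blast
  ultimately show ?thesis unfolding boundary_dist_def by (intro infdist_mono)
qed

lemma nearest_side:
  obtains L where "L \<in> sides P" "infdist z L = boundary_dist P z"
proof -
  obtain w where w: "w \<in> frontier P" "infdist z (frontier P) = dist z w"
    using infdist_attains_inf[OF frontier_closed frontier_nonempty] by metis
  then obtain L where L: "L \<in> sides P" "w \<in> L" using Union_sides by blast
  then have "infdist z L \<le> boundary_dist P z"
    using w by (simp add: boundary_dist_def infdist_le)
  with L(1) boundary_dist_le_infdist_side[OF L(1), of z] show ?thesis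
    by (intro that) auto
qed

lemma height_le_infdist:
  assumes L: "L \<in> sides P" shows "height L z \<le> infdist z L"
proof -
  have "L \<noteq> {}" using L by (auto simp: sides_def facet_of_def)
  moreover have "height L z \<le> dist z w" if "w \<in> L" for w
  proof -
    have "height L z = a L \<bullet> (w - z)"
      using that by (subst (asm) side_eq[OF L]) (simp add: height_def inner_diff_right)
    also have "\<dots> \<le> norm (a L) * norm (w - z)" by (rule norm_cauchy_schwarz)
    finally show ?thesis using norm_normal[OF L] by (simp add: dist_norm norm_minus_commute)
  qed
  ultimately show ?thesis by (simp add: infdist_def cINF_greatest)
qed

text \<open>On the way from \<open>z\<close> to its foot on the line of a side one meets the boundary, so the
  boundary is at most as far as the line; if the distances agree, then the foot lies on the side.\<close>

lemma
  assumes L: "L \<in> sides P" and z: "z \<in> P"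
  shows boundary_dist_le_height: "boundary_dist P z \<le> height L z"
    and infdist_side_le: "height L z \<le> boundary_dist P z \<Longrightarrow> infdist z L \<le> boundary_dist P z"
proof -
  define y where "y = z + height L z *\<^sub>R a L"
  have aa: "a L \<bullet> a L = 1" using norm_normal[OF L] by (simp add: dot_square_norm)
  have line: "a L \<bullet> y = b L" by (simp add: y_def height_def inner_add_right aa)
  have h0: "0 \<le> height L z" using support[OF L] z closure_subset by (force simp: height_def)
  then have dy: "dist z y = height L z" using norm_normal[OF L] by (simp add: y_def dist_norm)
  have "y \<notin> P"
  proof
    assume "y \<in> P"
    then obtain e where e: "e > 0" "cball y e \<subseteq> P" using open_P open_contains_cball by metis
    have "y + e *\<^sub>R a L \<in> cball y e" using e norm_normal[OF L] by (simp add: dist_norm)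
    then have "a L \<bullet> (y + e *\<^sub>R a L) \<le> b L" using e support[OF L] closure_subset by blast
    then show False using e by (simp add: inner_add_right line aa)
  qed
  then have "closed_segment z y \<inter> frontier P \<noteq> {}"
    using z by (intro connected_Int_frontier) auto
  then obtain w where w: "w \<in> closed_segment z y" "w \<in> frontier P" by blast
  have dw: "boundary_dist P z \<le> dist z w"
    unfolding boundary_dist_def using w by (intro infdist_le)
  have seg: "dist z y = dist z w + dist w y"
    using w(1) between_mem_segment between by metis
  show "boundary_dist P z \<le> height L z" using dw seg dy zero_le_dist[of w y] by linarith
  assume "height L z \<le> boundary_dist P z"
  then have "dist w y \<le> 0" using dw seg dy by linarith
  then have "y \<in> closure P" using w by (simp add: frontier_def)
  then have "y \<in> L" using side_eq[OF L] line by blast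
  then have "infdist z L \<le> dist z y" by (rule infdist_le)
  then show "infdist z L \<le> boundary_dist P z"
    using dy \<open>height L z \<le> boundary_dist P z\<close> by simp
qed

lemma part_iff:
  assumes L: "L \<in> sides P" and z: "z \<in> P"
  shows "z \<in> part P L \<longleftrightarrow> height L z = boundary_dist P z"
proof
  obtain M where M: "M \<in> sides P" "infdist z M = boundary_dist P z" by (rule nearest_side)
  assume "z \<in> part P L"
  then have "infdist z L \<le> boundary_dist P z" using M by (auto simp: part_def)
  then show "height L z = boundary_dist P z"
    using boundary_dist_le_height[OF L z] height_le_infdist[OF L, of z] by simp
next
  assume "height L z = boundary_dist P z"
  then have "infdist z L \<le> boundary_dist P z" using infdist_side_le[OF L z] by simp
  then show "z \<in> part P L"
    using z order_trans[OF _ boundary_dist_le_infdist_side] by (auto simp: part_def)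
qed

lemma part_eq:
  assumes L: "L \<in> sides P"
  shows "part P L = P \<inter> (\<Inter>M \<in> sides P. {z. height L z \<le> height M z})"
proof (rule set_eqI)
  fix z
  have "height L z = boundary_dist P z \<longleftrightarrow> (\<forall>M \<in> sides P. height L z \<le> height M z)"
    if z: "z \<in> P"
  proof -
    obtain M where M: "M \<in> sides P" "infdist z M = boundary_dist P z" by (rule nearest_side)
    then have "height M z = boundary_dist P z"
      using boundary_dist_le_height[OF M(1) z] height_le_infdist[OF M(1), of z] by simp
    then show ?thesis
      using boundary_dist_le_height[OF _ z] L M(1) by (metis order_antisym)
  qed
  then show "z \<in> part P L \<longleftrightarrow> z \<in> P \<inter> (\<Inter>M \<in> sides P. {z. height L z \<le> height M z})"
    using part_iff[OF L, of z] by (auto simp: part_def)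
qed

lemma height_le_halfspace:
  "{z. height L z \<le> height M z} = {z. (a M - a L) \<bullet> z \<le> b M - b L}"
  by (auto simp: height_def inner_diff_left)

text \<open>The closure of a nonempty part is cut out of the closed polygon by the closed half-planes of
  \<open>part_eq\<close>.\<close>

lemma polyhedron_closure_part:
  assumes L: "L \<in> sides P"
  shows "polyhedron (closure (part P L))"
proof (cases "part P L = {}")
  case False
  then obtain c where c: "c \<in> part P L" by blast
  define H where "H = (\<Inter>M \<in> sides P. {z. height L z \<le> height M z})"
  have polyH: "polyhedron H"
    unfolding H_def height_le_halfspace using finite_sides
    by (intro polyhedron_Inter) (auto simp: polyhedron_halfspace_le)
  have part_Int: "part P L = P \<inter> H" using part_eq[OF L] by (simp add: H_def)
  have "closure (part P L) = closure P \<inter> H"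
  proof (intro subset_antisym subsetI)
    fix z assume "z \<in> closure (part P L)"
    then show "z \<in> closure P \<inter> H"
      using closure_mono[of "P \<inter> H" P] closure_mono[of "P \<inter> H" H] part_Int
        closure_closed[OF polyhedron_imp_closed[OF polyH]] by auto
  next
    fix z assume z: "z \<in> closure P \<inter> H"
    show "z \<in> closure (part P L)"
    proof (cases "z = c")
      case True then show ?thesis using c closure_subset by blast
    next
      case False
      have "open_segment c z \<subseteq> P"
        using in_interior_closure_convex_segment[OF convex_P, of c z] z c part_Int open_P
        by (auto simp: interior_open)
      moreover have "closed_segment c z \<subseteq> H"
        using z c part_Int polyhedron_imp_convex[OF polyH] by (simp add: closed_segment_subset)
      ultimately have "open_segment c z \<subseteq> part P L"
        using part_Int segment_open_subset_closed by blast
      then have "closure (open_segment c z) \<subseteq> closure (part P L)" by (rule closure_mono)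
      then show ?thesis using False by (auto simp: closure_open_segment)
    qed
  qed
  then show ?thesis using polyH polytope_imp_polyhedron[OF polytope_P] by simp
qed simp

lemma compact_closure_part: "compact (closure (part P L))"
  using bounded_P by (simp add: part_def bounded_subset Collect_restrict)

lemma closure_part_subset: "closure (part P L) \<subseteq> closure P"
  by (intro closure_mono) (auto simp: part_def)

text \<open>In particular the boundary distance is affine on the closure of each part.\<close>

lemma boundary_dist_eq_height:
  assumes "L \<in> sides P" "z \<in> closure (part P L)"
  shows "boundary_dist P z = height L z"
proof -
  have "closed {z. boundary_dist P z = height L z}"
    unfolding boundary_dist_def height_def
    by (intro closed_Collect_eq continuous_intros)
  moreover have "part P L \<subseteq> {z. boundary_dist P z = height L z}"
    using part_iff[OF assms(1)] by (auto simp: part_def)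
  ultimately show ?thesis using closure_minimal assms(2) by blast
qed

section \<open>Maximizing over the vertices of the parts\<close>

text \<open>The vertices of the parts that do not lie on the boundary of \<open>P\<close>.\<close>

definition inner_vertices :: "complex set" where
  "inner_vertices = {x \<in> P. \<exists>L \<in> sides P. x extreme_point_of closure (part P L)}"

lemma finite_inner_vertices: "finite inner_vertices"
proof -
  have "finite (\<Union>L \<in> sides P. {x. x extreme_point_of closure (part P L)})"
    using finite_sides finite_polyhedron_extreme_points[OF polyhedron_closure_part] by blast
  then show ?thesis by (rule rev_finite_subset) (auto simp: inner_vertices_def)
qed

text \<open>An upper bound for the quotient at the inner vertices is an upper bound on all of \<open>P\<close>.\<close>

lemma boundary_dist_le_of_inner_vertices:
  assumes "0 \<le> m" and v: "v \<in> P"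
    and bound: "\<And>x. x \<in> inner_vertices \<Longrightarrow> boundary_dist P x \<le> m * conformal_radius P x"
  shows "boundary_dist P v \<le> m * conformal_radius P v"
proof -
  obtain L where L: "L \<in> sides P" "infdist v L = boundary_dist P v" by (rule nearest_side)
  let ?K = "closure (part P L)"
  have "v \<in> part P L"
    using v L(2) boundary_dist_le_infdist_side by (auto simp: part_def)
  then have vK: "v \<in> ?K" using closure_subset by blast
  have cvK: "convex ?K" by (rule polyhedron_imp_convex[OF polyhedron_closure_part[OF L(1)]])
  \<comment> \<open>A sublevel set of an affine minus a multiple of a concave function.\<close>
  define S where "S = {x \<in> ?K. height L x \<le> m * radius0 x}"
  have "convex S"
  proof (rule convexI)
    fix x y and s t :: real
    assume x: "x \<in> S" and y: "y \<in> S" and st: "0 \<le> s" "0 \<le> t" "s + t = 1"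
    have xyK: "x \<in> ?K" "y \<in> ?K" using x y by (auto simp: S_def)
    have "height L (s *\<^sub>R x + t *\<^sub>R y) = (s + t) * b L - s * (a L \<bullet> x) - t * (a L \<bullet> y)"
      using st by (simp add: height_def inner_add_right)
    also have "\<dots> = s * height L x + t * height L y"
      by (simp add: height_def algebra_simps)
    also have "\<dots> \<le> s * (m * radius0 x) + t * (m * radius0 y)"
      using x y st by (intro add_mono mult_left_mono) (auto simp: S_def)
    also have "\<dots> = m * (s * radius0 x + t * radius0 y)" by (simp add: algebra_simps)
    also have "\<dots> \<le> m * radius0 (s *\<^sub>R x + t *\<^sub>R y)"
      using concave_radius0 xyK closure_part_subset[of L] st \<open>0 \<le> m\<close>
      by (intro mult_left_mono) (simp_all add: concave_on_iff subset_iff)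
    finally show "s *\<^sub>R x + t *\<^sub>R y \<in> S"
      using convexD[OF cvK xyK st] by (simp add: S_def)
  qed
  moreover have "x \<in> S" if x: "x extreme_point_of ?K" for x
  proof -
    have xK: "x \<in> ?K" using x by (simp add: extreme_point_of_def)
    have "boundary_dist P x \<le> m * radius0 x"
    proof (cases "x \<in> P")
      case True
      then show ?thesis using bound[of x] x L(1) by (auto simp: inner_vertices_def radius0_def)
    next
      case False
      then have "x \<in> frontier P"
        using xK closure_part_subset[of L] open_P by (auto simp: frontier_def interior_open)
      then show ?thesis using False by (simp add: radius0_def boundary_dist_frontier)
    qed
    then show ?thesis using xK boundary_dist_eq_height[OF L(1) xK] by (simp add: S_def)
  qed
  ultimately have "convex hull {x. x extreme_point_of ?K} \<subseteq> S"
    by (intro hull_minimal) auto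
  then have "v \<in> S" using Krein_Milman_Minkowski[OF compact_closure_part cvK] vK by blast
  then show ?thesis using v boundary_dist_eq_height[OF L(1) vK] by (simp add: S_def radius0_def)
qed

text \<open>From a point inside an edge that reaches the boundary one can move to the inner endpoint of
  the edge, strictly increasing the boundary distance and not decreasing the quotient.\<close>

lemma higher_vertex:
  assumes E: "E \<in> graph_edges P" and meets: "endpoints E \<inter> frontier P \<noteq> {}"
    and u: "u \<in> P" "u \<in> E - endpoints E"
  shows "\<exists>q \<in> inner_vertices. boundary_dist P u < boundary_dist P q \<and>
    boundary_dist P u / conformal_radius P u \<le> boundary_dist P q / conformal_radius P q"
proof -
  obtain L where L: "L \<in> sides P" and facet: "E facet_of closure (part P L)"
    using E by (auto simp: graph_edges_def sides_def)
  let ?K = "closure (part P L)"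
  have cvK: "convex ?K" by (rule polyhedron_imp_convex[OF polyhedron_closure_part[OF L]])
  have face: "E face_of ?K" using facet by (rule facet_of_imp_face_of)
  have "aff_dim ?K \<le> 2" using aff_dim_le_DIM[of ?K] by simp
  then have "collinear E" using facet by (simp add: collinear_aff_dim facet_of_def)
  then obtain p0 q0 where seg: "E = closed_segment p0 q0"
    using compact_convex_collinear_segment[of E] u face
      face_of_imp_compact[OF cvK compact_closure_part face] face_of_imp_convex[OF face]
    by blast
  have ends: "endpoints E = {p0, q0}" by (auto simp: endpoints_def seg extreme_point_of_segment)
  obtain p q where pq: "E = closed_segment p q" "p \<in> frontier P" "endpoints E = {p, q}"
  proof (cases "p0 \<in> frontier P")
    case True
    then show ?thesis using that[of p0 q0] seg ends by simp
  next
    case False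
    then have "q0 \<in> frontier P" using meets ends by auto
    then show ?thesis
      using that[of q0 p0] seg ends by (simp add: closed_segment_commute insert_commute)
  qed
  obtain t where t: "0 \<le> t" "t \<le> 1" "u = (1 - t) *\<^sub>R p + t *\<^sub>R q"
    using u pq by (auto simp: in_segment)
  have t1: "t < 1" using t u pq by (cases "t = 1") auto
  have EK: "E \<subseteq> ?K" using face face_of_imp_subset by blast
  have d: "boundary_dist P x = height L x" if "x \<in> E" for x
    using boundary_dist_eq_height[OF L] EK that by blast
  have "p \<in> E" "q \<in> E" using pq by auto
  have "height L u = (1 - t) * height L p + t * height L q"
    by (simp add: t height_def inner_add_right algebra_simps)
  then have du: "boundary_dist P u = t * boundary_dist P q"
    using d \<open>p \<in> E\<close> \<open>q \<in> E\<close> u boundary_dist_frontier[OF pq(2)] by simp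
  then have dpos: "0 < t * boundary_dist P q" using boundary_dist_pos[OF u(1)] by simp
  then have dq: "0 < boundary_dist P q" and t0: "0 < t"
    using t by (auto simp: zero_less_mult_iff)
  have qP: "q \<in> P"
  proof (rule ccontr)
    assume "q \<notin> P"
    then have "q \<in> frontier P"
      using \<open>q \<in> E\<close> EK closure_part_subset[of L] open_P by (auto simp: frontier_def interior_open)
    then show False using dq boundary_dist_frontier by simp
  qed
  have "q extreme_point_of E" using pq by (auto simp: endpoints_def)
  then have "q extreme_point_of ?K" using extreme_point_of_face[OF face] by blast
  then have "q \<in> inner_vertices" using qP L by (auto simp: inner_vertices_def)
  moreover have "boundary_dist P u < boundary_dist P q" using du dq t1 by simp
  moreover have "t * conformal_radius P q \<le> conformal_radius P u"
  proof -
    have "(1 - t) * radius0 p + t * radius0 q \<le> radius0 u"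
      using concave_radius0 t pq(2) qP closure_subset unfolding concave_on_iff frontier_def
      by (metis DiffD1 add.commute diff_add_cancel diff_ge_0_iff_ge subset_iff)
    moreover have "p \<notin> P" using pq(2) open_P by (simp add: frontier_def interior_open)
    ultimately show ?thesis using qP u by (simp add: radius0_def)
  qed
  then have "boundary_dist P u / conformal_radius P u \<le> boundary_dist P q / conformal_radius P q"
    using radius_pos[OF qP] radius_pos[OF u(1)] dq unfolding du
    by (simp add: field_simps)
  ultimately show ?thesis by blast
qed

lemma maximum_attained_on_Gr:
  "\<exists>u \<in> P \<inter> Gr P. \<forall>v \<in> P.
     2 * boundary_dist P v / conformal_radius P v \<le> 2 * boundary_dist P u / conformal_radius P u"
proof -
  define f where "f = (\<lambda>x. boundary_dist P x / conformal_radius P x)"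
  have VP: "inner_vertices \<subseteq> P" by (auto simp: inner_vertices_def)
  have Vne: "inner_vertices \<noteq> {}"
  proof
    assume "inner_vertices = {}"
    moreover obtain v where "v \<in> P" using nonempty_P by blast
    ultimately show False
      using boundary_dist_le_of_inner_vertices[of 0 v] boundary_dist_pos[of v] by auto
  qed
  define m where "m = Max (f ` inner_vertices)"
  define W where "W = {x \<in> inner_vertices. f x = m}"
  have fle: "f x \<le> m" if "x \<in> inner_vertices" for x
    using that finite_inner_vertices by (simp add: m_def)
  have "m \<in> f ` inner_vertices"
    unfolding m_def using finite_inner_vertices Vne by (intro Max_in) auto
  then have W: "finite W" "W \<noteq> {}" using finite_inner_vertices by (auto simp: W_def)
  \<comment> \<open>Ties are broken in favour of the largest boundary distance.\<close>
  obtain u where u: "u \<in> W" and umax: "\<And>x. x \<in> W \<Longrightarrow> boundary_dist P x \<le> boundary_dist P u"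
  proof -
    have "Max (boundary_dist P ` W) \<in> boundary_dist P ` W" using W by (intro Max_in) auto
    then obtain u where "u \<in> W" "Max (boundary_dist P ` W) = boundary_dist P u" by auto
    then show ?thesis using W that[of u] by (metis Max_ge finite_imageI imageI)
  qed
  have uV: "u \<in> inner_vertices" and fu: "f u = m" using u by (auto simp: W_def)
  have uP: "u \<in> P" using uV VP by blast
  have m0: "0 \<le> m" using fu boundary_dist_pos[OF uP] radius_pos[OF uP] by (auto simp: f_def)
  have "f v \<le> m" if v: "v \<in> P" for v
  proof -
    have "boundary_dist P v \<le> m * conformal_radius P v"
    proof (rule boundary_dist_le_of_inner_vertices[OF m0 v])
      fix x assume "x \<in> inner_vertices"
      then show "boundary_dist P x \<le> m * conformal_radius P x"
        using fle[of x] radius_pos[of x] VP by (auto simp: f_def divide_le_eq)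
    qed
    then show ?thesis using radius_pos[OF v] by (simp add: f_def divide_le_eq)
  qed
  then have max: "2 * boundary_dist P v / conformal_radius P v
      \<le> 2 * boundary_dist P u / conformal_radius P u" if "v \<in> P" for v
    using that fu[symmetric] by (fastforce simp: f_def)
  obtain L where L: "L \<in> sides P" "u extreme_point_of closure (part P L)"
    using uV by (auto simp: inner_vertices_def)
  have "u \<notin> interior (part P L)"
    using extreme_point_not_in_interior[OF L(2)] interior_mono[OF closure_subset] by blast
  moreover have "u \<in> closure (part P L)" using L(2) by (simp add: extreme_point_of_def)
  ultimately have "u \<in> frontier (part P L)" by (simp add: frontier_def)
  moreover have "u \<notin> frontier P" using uP open_P by (simp add: frontier_def interior_open)
  moreover have "u \<notin> E - endpoints E"
    if E: "E \<in> graph_edges P" "endpoints E \<inter> frontier P \<noteq> {}" for E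
  proof
    assume uE: "u \<in> E - endpoints E"
    obtain q where q: "q \<in> inner_vertices" "boundary_dist P u < boundary_dist P q" "f u \<le> f q"
      using higher_vertex[OF E uP uE] by (auto simp: f_def)
    then have "q \<in> W" using fle[of q] fu by (simp add: W_def)
    then show False using umax[of q] q(2) by simp
  qed
  ultimately have "u \<in> Gr P" using L(1) unfolding Gr_def by blast
  with uP max show ?thesis by blast
qed

end

lemma unit_support_of_side:
  assumes "polytope (closure P)" "L \<in> sides P"
  shows "\<exists>a b. norm a = 1 \<and> closure P \<subseteq> {x. a \<bullet> x \<le> b} \<and> L = closure P \<inter> {x. a \<bullet> x = b}"
proof -
  obtain a b where ab: "a \<noteq> 0" "closure P \<subseteq> {x. a \<bullet> x \<le> b}" "L = closure P \<inter> {x. a \<bullet> x = b}"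
    using facet_of_polyhedron[OF polytope_imp_polyhedron[OF assms(1)]] assms(2)
    by (auto simp: sides_def)
  let ?a = "a /\<^sub>R norm a" and ?b = "b / norm a"
  have "norm ?a = 1" using ab(1) by simp
  moreover have "?a \<bullet> x \<le> ?b \<longleftrightarrow> a \<bullet> x \<le> b" "?a \<bullet> x = ?b \<longleftrightarrow> a \<bullet> x = b" for x
    using ab(1) by (auto simp: field_simps)
  ultimately show ?thesis using ab(2,3) by (intro exI[of _ ?a] exI[of _ ?b]) simp
qed

theorem theorem6p1:
  fixes P :: "complex set" and n :: nat
  assumes "n \<ge> 3"
    and "convex_ngon_domain n P"
  shows "\<exists>u \<in> P \<inter> Gr P. \<forall>v \<in> P.
           2 * boundary_dist P v / conformal_radius P v \<le> 2 * boundary_dist P u / conformal_radius P u"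
proof -
  have P: "open P" "convex P" "P \<noteq> {}" "polytope (closure P)"
    using assms(2) by (auto simp: convex_ngon_domain_def)
  obtain a b where "\<forall>L \<in> sides P. norm (a L) = 1 \<and> closure P \<subseteq> {x. a L \<bullet> x \<le> b L} \<and>
      L = closure P \<inter> {x. a L \<bullet> x = b L}"
    using unit_support_of_side[OF P(4)] by metis
  then interpret supported_polygon P a b
    using P by unfold_locales blast+
  show ?thesis by (rule maximum_attained_on_Gr)
qed

end
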